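(* For $r \in \mathbb{Q}_{>0}$, let $S_r$ denote the Puiseux monoid $\langle r^n \mid n \in \mathbb{N}_0 \rangle$. Then the following statements hold. (1) If $r \ge 1$, then $S_r$ is atomic and: either $r \in \mathbb{N}$, and so $S_r = \mathbb{N}_0$; or $r \notin \mathbb{N}$, and so $\mathcal{A}(S_r) = \{r^n \mid n \in \mathbb{N}_0\}$. (2) If $r < 1$, then: either $\mathsf{n}(r) = 1$, and so $S_r$ is antimatter; or $\mathsf{n}(r) \neq 1$, and $S_r$ is atomic with $\mathcal{A}(S_r) = \{r^n \mid n \in \mathbb{N}_0\}$.
   Context: $\mathbb{N} = \{1,2,3,\dots\}$ and $\mathbb{N}_0 = \mathbb{N}\cup\{0\}$. A Puiseux monoid is an additive submonoid of $\mathbb{Q}_{\ge 0}$; its only invertible element is $0$. For a set $S \subseteq \mathbb{Q}_{\ge 0}$, $\langle S \rangle$ denotes the additive submonoid generated by $S$. For $r \in \mathbb{Q}_{>0}$, $\mathsf{n}(r)$ is the numerator of $r$ in lowest terms. For a Puiseux monoid $M$, an element $a \in M\setminus\{0\}$ is an atom if $a = x+y$ with $x,y \in M$ implies $x = 0$ or $y = 0$; $\mathcal{A}(M)$ is the set of atoms of $M$. $M$ is atomic if each nonzero element of $M$ is a (finite) sum of atoms, and antimatter if $\mathcal{A}(M) = \emptyset$. *)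

theory Defs
  imports Complex_Main
begin

definition puiseux_monoid :: "rat set \<Rightarrow> bool" where
  "puiseux_monoid M \<longleftrightarrow>
     M \<subseteq> {0..} \<and> 0 \<in> M \<and> (\<forall>x\<in>M. \<forall>y\<in>M. x + y \<in> M)"

inductive_set gen_monoid :: "rat set \<Rightarrow> rat set" for S :: "rat set" where
  zero: "0 \<in> gen_monoid S"
| gen: "s \<in> S \<Longrightarrow> s \<in> gen_monoid S"
| add: "x \<in> gen_monoid S \<Longrightarrow> y \<in> gen_monoid S \<Longrightarrow> x + y \<in> gen_monoid S"

definition numerator :: "rat \<Rightarrow> int" where
  "numerator r = fst (quotient_of r)"

definition atoms :: "rat set \<Rightarrow> rat set" where
  "atoms M = {a \<in> M - {0}. \<forall>x\<in>M. \<forall>y\<in>M. a = x + y \<longrightarrow> x = 0 \<or> y = 0}"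

definition atomic_monoid :: "rat set \<Rightarrow> bool" where
  "atomic_monoid M \<longleftrightarrow> (\<forall>x\<in>M - {0}. \<exists>as. set as \<subseteq> atoms M \<and> x = sum_list as)"

definition antimatter :: "rat set \<Rightarrow> bool" where
  "antimatter M \<longleftrightarrow> atoms M = {}"

definition geom_monoid :: "rat \<Rightarrow> rat set" where
  "geom_monoid r = gen_monoid {r ^ n | n :: nat. True}"

lemma puiseux_monoid_gen_monoid:
  assumes "S \<subseteq> {0..}"
  shows "puiseux_monoid (gen_monoid S)"
proof -
  have "x \<ge> 0" if "x \<in> gen_monoid S" for x
    using that by induction (use assms in auto)
  then show ?thesis
    by (auto simp: puiseux_monoid_def intro: gen_monoid.intros)
qed

lemma gen_monoid_least:
  assumes "puiseux_monoid M" "S \<subseteq> M"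
  shows "gen_monoid S \<subseteq> M"
proof
  fix x assume "x \<in> gen_monoid S"
  then show "x \<in> M"
    by induction (use assms in \<open>auto simp: puiseux_monoid_def\<close>)
qed

lemma puiseux_monoid_geom_monoid: "r > 0 \<Longrightarrow> puiseux_monoid (geom_monoid r)"
  unfolding geom_monoid_def by (rule puiseux_monoid_gen_monoid) auto

end

(* Let r = a/b in lowest terms with a, b > 1. If r^n = x + y with x and y nonzero, then x and y
   are smaller than r^n, so for r > 1 they only involve powers r^i with i < n, and for r < 1 only
   powers with i > n. Clearing denominators gives b | a^n in the first case and a | b^N in the
   second, contradicting coprimality. Hence every r^n is an atom, and an atom of a generated
   monoid is always a generator. If a = 1 < b, then r^n = b r^(n+1) splits. *)
theory Submission
  imports Defs
begin

section \<open>Generated monoids: atoms and sums of generators\<close>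

lemma atoms_gen_monoid_subset: "atoms (gen_monoid S) \<subseteq> S"
proof
  fix x assume x: "x \<in> atoms (gen_monoid S)"
  then have "x \<in> gen_monoid S" by (simp add: atoms_def)
  then show "x \<in> S" using x
  proof induction
    case (add x y)
    \<comment> \<open>An atom written as a sum equals one of its summands, and the induction
      hypothesis applies to that summand.\<close>
    then have "x = 0 \<or> y = 0" unfolding atoms_def by blast
    with add show ?case by auto
  qed (auto simp: atoms_def)
qed

lemma gen_monoid_imp_sum_list:
  assumes "x \<in> gen_monoid S"
  shows "\<exists>as. set as \<subseteq> S \<and> x = sum_list as"
  using assms
proof induction
  case zero
  show ?case by (rule exI[of _ "[]"]) simp
next
  case (gen s)
  then show ?case by (intro exI[of _ "[s]"]) simp
next
  case (add x y)
  then obtain xs ys where "set xs \<subseteq> S" "x = sum_list xs" "set ys \<subseteq> S" "y = sum_list ys"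
    by blast
  then show ?case by (intro exI[of _ "xs @ ys"]) simp
qed

lemma atomic_gen_monoid:
  assumes "S \<subseteq> atoms (gen_monoid S)"
  shows "atomic_monoid (gen_monoid S)"
  using gen_monoid_imp_sum_list assms unfolding atomic_monoid_def by blast

lemma of_nat_mult_in_gen_monoid:
  "x \<in> gen_monoid S \<Longrightarrow> of_nat k * x \<in> gen_monoid S"
  by (induction k) (auto simp: algebra_simps intro: gen_monoid.intros)

section \<open>Monoids generated by powers: divisibility after clearing denominators\<close>

lemma power_in_geom_monoid: "r ^ n \<in> geom_monoid r"
  unfolding geom_monoid_def by (rule gen_monoid.gen) blast

lemma geom_monoid_nonneg: "r > 0 \<Longrightarrow> x \<in> geom_monoid r \<Longrightarrow> x \<ge> 0"
  using puiseux_monoid_geom_monoid[of r] by (auto simp: puiseux_monoid_def)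

text \<open>Rule induction with the generators in the explicit form \<open>r ^ n\<close>. The case
  \<open>add\<close> keeps the membership of both summands, which later yields their
  nonnegativity.\<close>

lemma geom_monoid_induct [consumes 1, case_names zero power add]:
  assumes "x \<in> geom_monoid r"
    and "P 0" and "\<And>n. P (r ^ n)"
    and "\<And>x y. x \<in> geom_monoid r \<Longrightarrow> y \<in> geom_monoid r \<Longrightarrow> P x \<Longrightarrow> P y \<Longrightarrow> P (x + y)"
  shows "P x"
  using assms(1) unfolding geom_monoid_def
  by (induction rule: gen_monoid.induct) (use assms(2-) in \<open>auto simp: geom_monoid_def\<close>)

text \<open>Only powers \<open>r ^ i\<close> with \<open>i < n\<close> can occur in
  \<open>x\<close>, so \<open>b ^ n\<close> clears all denominators and leaves a factor
  \<open>b\<close> over. The bound by \<open>r ^ n\<close> passes to the summands because they are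
  nonnegative.\<close>

lemma geom_monoid_less_power_ge_1:
  fixes a b :: int
  assumes "x \<in> geom_monoid r" "r = of_int a / of_int b" "b > 0" "r \<ge> 1" "x < r ^ n"
  shows "\<exists>k. x * of_int b ^ n = of_int (b * k)"
  using assms(1,5)
proof (induction rule: geom_monoid_induct)
  case zero
  show ?case by (rule exI[of _ 0]) simp
next
  case (power i)
  then have "i < n"
    using power_increasing[of n i r] \<open>r \<ge> 1\<close> by (meson leD leI)
  \<comment> \<open>The successor records that \<open>i < n\<close> is strict; it supplies the spare
    factor \<open>b\<close> in \<open>b ^ n = b ^ i * b * b ^ j\<close>.\<close>
  then obtain j where n: "n = i + Suc j" using less_imp_Suc_add by auto
  have "r ^ i * of_int b ^ n = of_int (b * (a ^ i * b ^ j))"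
    using \<open>b > 0\<close> by (simp add: assms(2) n power_add power_divide)
  then show ?case by blast
next
  case (add x y)
  have "x \<ge> 0" "y \<ge> 0" using add.hyps \<open>r \<ge> 1\<close> geom_monoid_nonneg[of r] by auto
  with add.prems have "x < r ^ n" "y < r ^ n" by auto
  with add.IH obtain k l
    where "x * of_int b ^ n = of_int (b * k)" "y * of_int b ^ n = of_int (b * l)" by blast
  then have "(x + y) * of_int b ^ n = of_int (b * (k + l))" by (simp add: algebra_simps)
  then show ?case by blast
qed

text \<open>Here the exponents in \<open>x\<close> exceed \<open>n\<close> and have no common upper
  bound, so \<open>N\<close> depends on \<open>x\<close>. With \<open>r ^ n\<close> factored out,
  each term leaves \<open>r ^ (i - n)\<close>, whose numerator is divisible by
  \<open>a\<close>.\<close>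

lemma geom_monoid_less_power_le_1:
  fixes a b :: int
  assumes "x \<in> geom_monoid r" "r = of_int a / of_int b" "b > 0" "0 < r" "r \<le> 1" "x < r ^ n"
  shows "\<exists>N k. x * of_int b ^ N = r ^ n * of_int (a * k)"
  using assms(1,6)
proof (induction rule: geom_monoid_induct)
  case zero
  show ?case by (rule exI, rule exI[of _ 0]) simp
next
  case (power i)
  then have "n < i"
    using power_decreasing[of i n r] \<open>0 < r\<close> \<open>r \<le> 1\<close> by (meson leD leI less_imp_le)
  then obtain j where i: "i = n + Suc j" using less_imp_Suc_add by auto
  have "r ^ Suc j * of_int b ^ Suc j = of_int (a * a ^ j)"
    using \<open>b > 0\<close> by (simp add: assms(2) power_divide)
  then have "r ^ i * of_int b ^ Suc j = r ^ n * of_int (a * a ^ j)"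
    unfolding i power_add by (simp add: mult.assoc)
  then show ?case by blast
next
  case (add x y)
  have "x \<ge> 0" "y \<ge> 0" using add.hyps \<open>0 < r\<close> geom_monoid_nonneg[of r] by auto
  with add.prems have "x < r ^ n" "y < r ^ n" by auto
  with add.IH obtain N k M l where
    x: "x * of_int b ^ N = r ^ n * of_int (a * k)" and
    y: "y * of_int b ^ M = r ^ n * of_int (a * l)" by metis
  \<comment> \<open>\<open>N\<close> and \<open>M\<close> may differ; \<open>N + M\<close> serves as
    a common exponent.\<close>
  have "(x + y) * of_int b ^ (N + M) =
      (x * of_int b ^ N) * of_int b ^ M + (y * of_int b ^ M) * of_int b ^ N"
    by (simp add: algebra_simps power_add)
  also have "\<dots> = r ^ n * of_int (a * (k * b ^ M + l * b ^ N))"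
    unfolding x y by (simp add: algebra_simps)
  finally show ?case by blast
qed

section \<open>The powers of a non-integer \<open>r\<close> with numerator above 1 as atoms\<close>

lemma power_in_atoms_geom_monoid:
  fixes a b :: int
  assumes r: "r = of_int a / of_int b" and "coprime a b" "a > 1" "b > 1"
  shows "r ^ n \<in> atoms (geom_monoid r)"
proof -
  have "r > 0" using assms by simp
  have False if xy: "x \<in> geom_monoid r" "y \<in> geom_monoid r" "r ^ n = x + y" "x \<noteq> 0" "y \<noteq> 0"
    for x y
  proof -
    have "x \<ge> 0" "y \<ge> 0" using geom_monoid_nonneg xy \<open>r > 0\<close> by auto
    \<comment> \<open>Both summands are positive, so each lies strictly below the sum
      \<open>r ^ n\<close>.\<close>
    with xy have less: "x < r ^ n" "y < r ^ n" by auto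
    show False
    proof (cases "r \<ge> 1")
      case True
      then obtain k l where
        "x * of_int b ^ n = of_int (b * k)" "y * of_int b ^ n = of_int (b * l)"
        using geom_monoid_less_power_ge_1[OF _ r] xy less \<open>b > 1\<close> by (metis less_trans zero_less_one)
      then have "r ^ n * of_int b ^ n = of_int (b * (k + l))"
        using xy by (simp add: algebra_simps)
      moreover have "r ^ n * of_int b ^ n = of_int (a ^ n)"
        using \<open>b > 1\<close> by (simp add: r power_divide)
      ultimately have "a ^ n = b * (k + l)" by (metis of_int_eq_iff)
      then have "b dvd a ^ n" by simp
      moreover have "coprime b (a ^ n)" using \<open>coprime a b\<close> by (simp add: coprime_commute)
      ultimately have "is_unit b" by (metis coprime_absorb_left)
      with \<open>b > 1\<close> show False by simp
    next
      case False
      then have "r \<le> 1" by simp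
      then obtain N k M l where
        x: "x * of_int b ^ N = r ^ n * of_int (a * k)" and
        y: "y * of_int b ^ M = r ^ n * of_int (a * l)"
        using geom_monoid_less_power_le_1[OF _ r] xy less \<open>b > 1\<close> \<open>r > 0\<close>
        by (metis less_trans zero_less_one)
      have "r ^ n * of_int (b ^ (N + M)) =
          (x * of_int b ^ N) * of_int b ^ M + (y * of_int b ^ M) * of_int b ^ N"
        using xy by (simp add: algebra_simps power_add)
      also have "\<dots> = r ^ n * of_int (a * (k * b ^ M + l * b ^ N))"
        unfolding x y by (simp add: algebra_simps)
      \<comment> \<open>Cancelling the nonzero \<open>r ^ n\<close> leaves an equation between
        integers embedded in the rationals.\<close>
      finally have "b ^ (N + M) = a * (k * b ^ M + l * b ^ N)"
        using \<open>r > 0\<close> by (metis mult_left_cancel of_int_eq_iff power_not_zero less_irrefl)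
      then have "a dvd b ^ (N + M)" by simp
      moreover have "coprime a (b ^ (N + M))" using \<open>coprime a b\<close> by simp
      ultimately have "is_unit a" by (metis coprime_absorb_left)
      with \<open>a > 1\<close> show False by simp
    qed
  qed
  then show ?thesis
    using power_in_geom_monoid \<open>r > 0\<close> by (auto simp: atoms_def)
qed

lemma geom_monoid_atomic:
  fixes a b :: int
  assumes "r = of_int a / of_int b" "coprime a b" "a > 1" "b > 1"
  shows "atomic_monoid (geom_monoid r)"
    and "atoms (geom_monoid r) = {r ^ n | n :: nat. True}"
proof -
  have *: "{r ^ n | n :: nat. True} \<subseteq> atoms (geom_monoid r)"
    using power_in_atoms_geom_monoid[OF assms] by blast
  then show "atomic_monoid (geom_monoid r)"
    unfolding geom_monoid_def by (rule atomic_gen_monoid)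
  show "atoms (geom_monoid r) = {r ^ n | n :: nat. True}"
    using * atoms_gen_monoid_subset unfolding geom_monoid_def by blast
qed

section \<open>The natural and the antimatter case\<close>

lemma power_in_Nats: "r \<in> \<nat> \<Longrightarrow> r ^ n \<in> \<nat>" for r :: "'a::semiring_1"
  by (induction n) auto

lemma geom_monoid_Nats:
  assumes "r \<in> \<nat>"
  shows "geom_monoid r = \<nat>"
proof
  show "geom_monoid r \<subseteq> \<nat>"
  proof
    fix x assume "x \<in> geom_monoid r"
    then show "x \<in> \<nat>" by (induction rule: geom_monoid_induct) (use assms in \<open>auto intro: power_in_Nats\<close>)
  qed
  \<comment> \<open>\<open>of_nat k\<close> is \<open>k\<close> times the generator
    \<open>r ^ 0 = 1\<close>.\<close>
  have "of_nat k \<in> geom_monoid r" for k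
    using of_nat_mult_in_gen_monoid[of 1] power_in_geom_monoid[of r 0]
    by (simp add: geom_monoid_def)
  then show "\<nat> \<subseteq> geom_monoid r" by (auto elim: Nats_cases)
qed

text \<open>For a natural \<open>r > 1\<close> not all powers are atoms, since
  \<open>r = 1 + (r - 1)\<close>. Instead 1 is shown to be an atom, and \<open>k\<close> is a sum of
  \<open>k\<close> ones.\<close>

lemma atomic_monoid_Nats: "atomic_monoid \<nat>"
  unfolding atomic_monoid_def
proof
  fix x :: rat assume "x \<in> \<nat> - {0}"
  then obtain k where "x = of_nat k" by (auto elim: Nats_cases)
  moreover have "x = 0 \<or> y = 0" if "1 = x + y" "x \<in> \<nat>" "y \<in> \<nat>" for x y :: rat
  proof -
    obtain m n where mn: "x = of_nat m" "y = of_nat n" using \<open>x \<in> \<nat>\<close> \<open>y \<in> \<nat>\<close> by (auto elim!: Nats_cases)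
    then have "of_nat (m + n) = (of_nat 1 :: rat)" using \<open>1 = x + y\<close> by simp
    then have "m + n = 1" by (simp only: of_nat_eq_iff)
    then show ?thesis using mn by auto
  qed
  then have "1 \<in> atoms \<nat>" by (auto simp: atoms_def)
  ultimately show "\<exists>as. set as \<subseteq> atoms \<nat> \<and> x = sum_list as"
    by (intro exI[of _ "replicate k 1"]) (auto simp: sum_list_replicate)
qed

lemma antimatter_geom_monoid:
  fixes b :: int
  assumes r: "r = 1 / of_int b" and "b > 1"
  shows "antimatter (geom_monoid r)"
proof -
  have "r > 0" using assms by simp
  have "r ^ n \<notin> atoms (geom_monoid r)" for n
  proof
    assume atom: "r ^ n \<in> atoms (geom_monoid r)"
    \<comment> \<open>One of the \<open>b\<close> copies of \<open>r ^ Suc n\<close> that add up to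
      \<open>r ^ n\<close> is split off. The other \<open>b - 1\<close> copies have a nonzero sum
      because \<open>b > 1\<close>; \<open>nat\<close> turns their number into a natural
      multiplier.\<close>
    let ?x = "r ^ Suc n" and ?y = "of_nat (nat (b - 1)) * r ^ Suc n"
    have b: "of_nat (nat (b - 1)) = (of_int b - 1 :: rat)" using \<open>b > 1\<close> by simp
    have "r ^ n = ?x + ?y" unfolding b using assms by (simp add: field_simps)
    moreover have "?x \<in> geom_monoid r" by (rule power_in_geom_monoid)
    moreover from this have "?y \<in> geom_monoid r"
      unfolding geom_monoid_def by (rule of_nat_mult_in_gen_monoid)
    ultimately have "?x = 0 \<or> ?y = 0" using atom unfolding atoms_def by blast
    with \<open>r > 0\<close> \<open>b > 1\<close> show False by simp
  qed
  then show ?thesis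
    using atoms_gen_monoid_subset unfolding antimatter_def geom_monoid_def by blast
qed

theorem proposition4p3:
  fixes r :: rat
  assumes "r > 0"
  shows "(r \<ge> 1 \<longrightarrow>
            atomic_monoid (geom_monoid r) \<and>
            ((r \<in> \<nat> \<and> geom_monoid r = \<nat>) \<or>
             (r \<notin> \<nat> \<and> atoms (geom_monoid r) = {r ^ n | n :: nat. True})))
       \<and> (r < 1 \<longrightarrow>
            (numerator r = 1 \<and> antimatter (geom_monoid r)) \<or>
            (numerator r \<noteq> 1 \<and> atomic_monoid (geom_monoid r) \<and>
             atoms (geom_monoid r) = {r ^ n | n :: nat. True}))"
proof -
  obtain a b where ab: "quotient_of r = (a, b)" by fastforce
  have r: "r = of_int a / of_int b" and "coprime a b" and "b > 0"
    using ab quotient_of_div quotient_of_coprime quotient_of_denom_pos by auto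
  have "a > 0" using \<open>r > 0\<close> \<open>b > 0\<close> by (simp add: r zero_less_divide_iff)
  have num: "numerator r = a" by (simp add: numerator_def ab)
  show ?thesis
  proof (cases "r \<ge> 1")
    case ge: True
    show ?thesis
    proof (cases "r \<in> \<nat>")
      case True
      then show ?thesis using ge geom_monoid_Nats atomic_monoid_Nats by simp
    next
      case False
      have "b \<noteq> 1"
      proof
        assume "b = 1"
        then have "r = of_nat (nat a)" using \<open>a > 0\<close> by (simp add: r)
        with False show False by simp
      qed
      with \<open>b > 0\<close> have "b > 1" by simp
      \<comment> \<open>Together with \<open>b > 1\<close> this gives \<open>a > 1\<close>.\<close>
      moreover have "a \<ge> b" using ge \<open>b > 0\<close> by (simp add: r)
      ultimately show ?thesis
        using geom_monoid_atomic[OF r \<open>coprime a b\<close>] ge False by simp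
    qed
  next
    case False
    then have "a < b" using \<open>b > 0\<close> by (simp add: r)
    show ?thesis
    proof (cases "a = 1")
      case True
      then show ?thesis
        using False \<open>a < b\<close> num antimatter_geom_monoid[of r b] by (simp add: r)
    next
      case False
      \<comment> \<open>A positive \<open>a\<close> other than 1 exceeds 1, and then
        \<open>b > a\<close> exceeds 1 as well.\<close>
      then show ?thesis
        using \<open>\<not> r \<ge> 1\<close> \<open>a > 0\<close> \<open>a < b\<close> num geom_monoid_atomic[OF r \<open>coprime a b\<close>] by simp
    qed
  qed
qed

end
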